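(* For any $\delta>0$ and integer $n\ge1$, the function $$f(\alpha_1,\dots,\alpha_n)=\prod_{i=1}^n\alpha_i^{-\delta}$$ is convex on its natural domain $\{(\alpha_1,\dots,\alpha_n)\in\mathbb{R}^n:\alpha_i>0\text{ for }i=1,\dots,n\}$. *)

theory Defs
  imports "HOL-Analysis.Analysis"
begin

end

theory Submission
  imports Defs
begin

text \<open>
  Taking logarithms turns the product into a sum of one-variable functions:
  \<open>ln (\<Prod>i. \<alpha> $ i powr (- \<delta>)) = \<delta> * (\<Sum>i. - ln (\<alpha> $ i))\<close>. Each summand is convex because
  \<open>ln\<close> is concave and the coordinate maps are linear, so the logarithm of the product is convex.
  Exponentiating preserves convexity, since \<open>exp\<close> is convex and, what matters just as much,
  increasing (lemma \<open>convex_on_exp_compose\<close>). The detour through logarithms is needed because a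
  product of positive convex functions need not be convex, whereas log-convexity is stable
  under products.
\<close>

text \<open>
  Monotonicity of \<open>exp\<close> carries the convexity inequality of \<open>g\<close> through the exponential;
  convexity of \<open>exp\<close> then splits the resulting convex combination in the exponent.
\<close>

lemma convex_on_exp_compose:
  fixes g :: "'a::real_vector \<Rightarrow> real"
  assumes "convex_on S g"
  shows "convex_on S (\<lambda>x. exp (g x))"
proof (intro convex_onI)
  show "convex S"
    using assms by (rule convex_on_imp_convex)
  fix t x y assume "0 < t" "t < (1::real)" "x \<in> S" "y \<in> S"
  then have "g ((1 - t) *\<^sub>R x + t *\<^sub>R y) \<le> (1 - t) * g x + t * g y"
    using convex_onD[OF assms] by simp
  then have "exp (g ((1 - t) *\<^sub>R x + t *\<^sub>R y)) \<le> exp ((1 - t) * g x + t * g y)"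
    by simp
  also have "\<dots> \<le> (1 - t) * exp (g x) + t * exp (g y)"
    using convex_onD[OF exp_convex, of t "g x" "g y"] \<open>0 < t\<close> \<open>t < 1\<close> by simp
  finally show "exp (g ((1 - t) *\<^sub>R x + t *\<^sub>R y)) \<le> (1 - t) * exp (g x) + t * exp (g y)" .
qed

lemma convex_on_linear_compose:
  fixes g :: "'b::real_vector \<Rightarrow> real"
  assumes "convex_on T g" "linear h" "convex S" "h ` S \<subseteq> T"
  shows "convex_on S (\<lambda>x. g (h x))"
proof (intro convex_onI)
  fix t x y assume "0 < t" "t < (1::real)" "x \<in> S" "y \<in> S"
  then show "g (h ((1 - t) *\<^sub>R x + t *\<^sub>R y)) \<le> (1 - t) * g (h x) + t * g (h y)"
    using convex_onD[OF assms(1), of t "h x" "h y"] assms(4)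
    by (auto simp: linear_add[OF assms(2)] linear_cmul[OF assms(2)])
qed (fact assms(3))

lemma convex_on_sum_of_functions:
  fixes g :: "'i \<Rightarrow> 'a::real_vector \<Rightarrow> real"
  assumes "convex S" "\<And>i. i \<in> I \<Longrightarrow> convex_on S (g i)"
  shows "convex_on S (\<lambda>x. \<Sum>i\<in>I. g i x)"
  using assms(2)
  by (induction I rule: infinite_finite_induct)
     (auto simp: convex_on_const assms(1) intro: convex_on_add)

lemma convex_on_eq_on:
  fixes f g :: "'a::real_vector \<Rightarrow> real"
  assumes "convex_on S f" "\<And>x. x \<in> S \<Longrightarrow> f x = g x"
  shows "convex_on S g"
proof (intro convex_onI)
  show "convex S"
    using assms(1) by (rule convex_on_imp_convex)
  fix t x y assume *: "0 < t" "t < (1::real)" "x \<in> S" "y \<in> S"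
  then have "(1 - t) *\<^sub>R x + t *\<^sub>R y \<in> S"
    using \<open>convex S\<close> by (intro convexD) auto
  then show "g ((1 - t) *\<^sub>R x + t *\<^sub>R y) \<le> (1 - t) * g x + t * g y"
    using convex_onD[OF assms(1), of t x y] * by (simp add: assms(2))
qed

lemma convex_positive_orthant: "convex {\<alpha> :: real ^ 'n. \<forall>i. \<alpha> $ i > 0}"
proof -
  have "{\<alpha> :: real ^ 'n. \<forall>i. \<alpha> $ i > 0} = (\<Inter>i. (\<lambda>\<alpha>. \<alpha> $ i) -` {0<..})"
    by auto
  then show ?thesis
    by (simp only:) (intro convex_INT convex_linear_vimage bounded_linear.linear
        bounded_linear_vec_nth convex_real_interval)
qed

lemma convex_on_minus_ln: "convex_on {0<..} (\<lambda>x::real. - ln x)"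
  using minus_log_convex[of "exp 1"] by (simp add: log_def)

theorem lemma6p2:
  fixes \<delta> :: real
  assumes "\<delta> > 0"
  shows "convex_on {\<alpha> :: real ^ 'n. \<forall>i. \<alpha> $ i > 0}
           (\<lambda>\<alpha>. \<Prod>i\<in>UNIV. (\<alpha> $ i) powr (- \<delta>))"
proof -
  let ?P = "{\<alpha> :: real ^ 'n. \<forall>i. \<alpha> $ i > 0}"
  have ln_coord: "convex_on ?P (\<lambda>\<alpha>. \<delta> * - ln (\<alpha> $ i))" for i
    using assms
    by (intro convex_on_cmul convex_on_linear_compose[OF convex_on_minus_ln]
        convex_positive_orthant bounded_linear.linear bounded_linear_vec_nth) auto
  have "convex_on ?P (\<lambda>\<alpha>. \<Sum>i\<in>UNIV. \<delta> * - ln (\<alpha> $ i))"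
    by (intro convex_on_sum_of_functions ln_coord convex_positive_orthant)
  then have "convex_on ?P (\<lambda>\<alpha>. exp (\<Sum>i\<in>UNIV. \<delta> * - ln (\<alpha> $ i)))"
    by (rule convex_on_exp_compose)
  moreover have "exp (\<Sum>i\<in>UNIV. \<delta> * - ln (\<alpha> $ i)) = (\<Prod>i\<in>UNIV. (\<alpha> $ i) powr (- \<delta>))"
    if "\<alpha> \<in> ?P" for \<alpha> :: "real ^ 'n"
  proof -
    have "\<alpha> $ i \<noteq> 0" for i
      using that by (metis (mono_tags) less_irrefl mem_Collect_eq)
    then show ?thesis
      by (simp add: exp_sum powr_def flip: sum_negf)
  qed
  ultimately show ?thesis
    by (rule convex_on_eq_on)
qed

end
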